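(* Let $V$ be a real vector space of finite dimension $m\ge 3$, and let $\mathcal{A}\in\mathfrak{A}(V)$ be a generalized algebraic curvature operator. (1) If $\mathcal{A}$ is projectively flat, then there exists a projectively flat torsion free connection $\nabla$ on $TV$ such that $\mathcal{R}^\nabla_0=\mathcal{A}$. (2) If $\mathcal{A}$ is projectively flat and Ricci symmetric, then there exists a projectively flat and Ricci symmetric torsion free connection $\nabla$ on $TV$ such that $\mathcal{R}^\nabla_0=\mathcal{A}$.
   Context: The space $V$ is regarded as a smooth manifold, with $T_PV$ identified with $V$ in the canonical way for every $P\in V$. A generalized algebraic curvature operator on $V$ is a tensor $\mathcal{A}\in\otimes^2V^*\otimes\operatorname{End}(V)$ with $\mathcal{A}(x,y)=-\mathcal{A}(y,x)$ and $\mathcal{A}(x,y)z+\mathcal{A}(y,z)x+\mathcal{A}(z,x)y=0$ for all $x,y,z\in V$; $\mathfrak{A}(V)$ is the space of all such operators. The Ricci tensor of $\mathcal{A}$ is $\rho(\mathcal{A})(x,y):=\operatorname{Tr}\{z\mapsto\mathcal{A}(z,x)y\}$, and $\rho_s(\mathcal{A})$, $\rho_a(\mathcal{A})$ denote its symmetric and antisymmetric parts, $\rho_s(\mathcal{A})(x,y)=\frac12\{\rho(\mathcal{A})(x,y)+\rho(\mathcal{A})(y,x)\}$, $\rho_a(\mathcal{A})(x,y)=\frac12\{\rho(\mathcal{A})(x,y)-\rho(\mathcal{A})(y,x)\}$. $\mathcal{A}$ is Ricci symmetric if $\rho_a(\mathcal{A})=0$. For $\Theta\in V^*\otimes V^*$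 define $H(\Theta)\in\mathfrak{A}(V)$ by $H(\Theta)(x,y)z:=\Theta(x,y)z-\Theta(y,x)z+\Theta(x,z)y-\Theta(y,z)x$. Set $\mathcal{P}(\mathcal{A}):=\mathcal{A}+\frac1{m-1}H(\rho_s(\mathcal{A}))+\frac1{1+m}H(\rho_a(\mathcal{A}))$. $\mathcal{A}$ is projectively flat if $\mathcal{P}(\mathcal{A})=0$ or, equivalently, if there exists $\Theta\in V^*\otimes V^*$ with $\mathcal{A}=H(\Theta)$. For a torsion free connection $\nabla$ on the tangent bundle, the curvature operator is $\mathcal{R}^\nabla(x,y):=\nabla_x\nabla_y-\nabla_y\nabla_x-\nabla_{[x,y]}$, and $\mathcal{R}^\nabla_P\in\mathfrak{A}(T_PV)$ denotes its value at the point $P$. The connection $\nabla$ is projectively flat (resp. Ricci symmetric) if $\mathcal{R}^\nabla_P$ is projectively flat (resp. Ricci symmetric) for every point $P$. *)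

theory Defs
  imports "HOL-Analysis.Analysis"
begin

text \<open>
  The real vector space \<open>V\<close> of finite dimension \<open>m\<close> is a type of class
  \<open>euclidean_space\<close>, and \<open>m = DIM('a)\<close>. None of the notions below depends on the
  inner product: it supplies the standard topology of \<open>V\<close> (for differentiation) and a basis
  (for the trace).
\<close>

section \<open>Generalized algebraic curvature operators\<close>

text \<open>An element of \<open>\<otimes>\<^sup>2V\<^sup>* \<otimes> End(V)\<close> is a trilinear map
  \<open>V \<times> V \<times> V \<rightarrow> V\<close>; \<open>A x y z\<close> stands for \<open>A(x,y)z\<close>.\<close>

type_synonym 'a curv_op = "'a \<Rightarrow> 'a \<Rightarrow> 'a \<Rightarrow> 'a"

definition curvature_operators :: "'a::euclidean_space curv_op set" where
  "curvature_operators = {A.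
     (\<forall>z. bilinear (\<lambda>x y. A x y z)) \<and> (\<forall>x y. linear (A x y)) \<and>
     (\<forall>x y z. A x y z = - A y x z) \<and>
     (\<forall>x y z. A x y z + A y z x + A z x y = 0)}"

definition endo_trace :: "('a::euclidean_space \<Rightarrow> 'a) \<Rightarrow> real" where
  "endo_trace f = (\<Sum>b\<in>Basis. f b \<bullet> b)"

definition ricci :: "'a::euclidean_space curv_op \<Rightarrow> 'a \<Rightarrow> 'a \<Rightarrow> real" where
  "ricci A x y = endo_trace (\<lambda>z. A z x y)"

definition ricci_sym :: "'a::euclidean_space curv_op \<Rightarrow> 'a \<Rightarrow> 'a \<Rightarrow> real" where
  "ricci_sym A x y = (ricci A x y + ricci A y x) / 2"

definition ricci_alt :: "'a::euclidean_space curv_op \<Rightarrow> 'a \<Rightarrow> 'a \<Rightarrow> real" where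
  "ricci_alt A x y = (ricci A x y - ricci A y x) / 2"

definition ricci_symmetric :: "'a::euclidean_space curv_op \<Rightarrow> bool" where
  "ricci_symmetric A \<longleftrightarrow> (\<forall>x y. ricci_alt A x y = 0)"

definition H_op :: "('a::euclidean_space \<Rightarrow> 'a \<Rightarrow> real) \<Rightarrow> 'a curv_op" where
  "H_op \<Theta> x y z = \<Theta> x y *\<^sub>R z - \<Theta> y x *\<^sub>R z + \<Theta> x z *\<^sub>R y - \<Theta> y z *\<^sub>R x"

definition proj_curv :: "'a::euclidean_space curv_op \<Rightarrow> 'a curv_op" where
  "proj_curv A x y z = A x y z
     + (1 / (real DIM('a) - 1)) *\<^sub>R H_op (ricci_sym A) x y z
     + (1 / (1 + real DIM('a))) *\<^sub>R H_op (ricci_alt A) x y z"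

definition projectively_flat :: "'a::euclidean_space curv_op \<Rightarrow> bool" where
  "projectively_flat A \<longleftrightarrow> (\<forall>x y z. proj_curv A x y z = 0)"

section \<open>Smooth functions and vector fields on \<open>V\<close>\<close>

text \<open>\<open>C_k k f\<close>: \<open>f\<close> is \<open>k\<close> times continuously differentiable on the
  whole space. As the domain is finite-dimensional, it suffices to iterate directional derivatives
  of (totally) differentiable functions.\<close>

primrec C_k :: "nat \<Rightarrow> ('a::euclidean_space \<Rightarrow> 'b::real_normed_vector) \<Rightarrow> bool" where
  "C_k 0 f \<longleftrightarrow> continuous_on UNIV f"
| "C_k (Suc k) f \<longleftrightarrow> (\<forall>p. f differentiable (at p)) \<and>
     (\<forall>v. C_k k (\<lambda>p. frechet_derivative f (at p) v))"

definition smooth :: "('a::euclidean_space \<Rightarrow> 'b::real_normed_vector) \<Rightarrow> bool" where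
  "smooth f \<longleftrightarrow> (\<forall>k. C_k k f)"

text \<open>Since \<open>T\<^sub>PV = V\<close> canonically, a vector field is a map \<open>V \<rightarrow> V\<close>.\<close>

type_synonym 'a vfield = "'a \<Rightarrow> 'a"

definition lie_bracket :: "'a::euclidean_space vfield \<Rightarrow> 'a vfield \<Rightarrow> 'a vfield" where
  "lie_bracket X Y =
     (\<lambda>p. frechet_derivative Y (at p) (X p) - frechet_derivative X (at p) (Y p))"

section \<open>Connections on \<open>TV\<close>\<close>

text \<open>Koszul connections, \<open>nabla X Y\<close> being \<open>\<nabla>\<^sub>X Y\<close>. The values of
  \<open>nabla\<close> on non-smooth arguments are irrelevant.\<close>

definition connection :: "('a::euclidean_space vfield \<Rightarrow> 'a vfield \<Rightarrow> 'a vfield) \<Rightarrow> bool" where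
  "connection nabla \<longleftrightarrow>
     (\<forall>X Y. smooth X \<longrightarrow> smooth Y \<longrightarrow> smooth (nabla X Y)) \<and>
     (\<forall>X X' Y. smooth X \<longrightarrow> smooth X' \<longrightarrow> smooth Y \<longrightarrow>
        nabla (\<lambda>p. X p + X' p) Y = (\<lambda>p. nabla X Y p + nabla X' Y p)) \<and>
     (\<forall>(f :: 'a \<Rightarrow> real) X Y. smooth f \<longrightarrow> smooth X \<longrightarrow> smooth Y \<longrightarrow>
        nabla (\<lambda>p. f p *\<^sub>R X p) Y = (\<lambda>p. f p *\<^sub>R nabla X Y p)) \<and>
     (\<forall>X Y Y'. smooth X \<longrightarrow> smooth Y \<longrightarrow> smooth Y' \<longrightarrow>
        nabla X (\<lambda>p. Y p + Y' p) = (\<lambda>p. nabla X Y p + nabla X Y' p)) \<and>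
     (\<forall>(f :: 'a \<Rightarrow> real) X Y. smooth f \<longrightarrow> smooth X \<longrightarrow> smooth Y \<longrightarrow>
        nabla X (\<lambda>p. f p *\<^sub>R Y p) =
          (\<lambda>p. frechet_derivative f (at p) (X p) *\<^sub>R Y p + f p *\<^sub>R nabla X Y p))"

definition torsion_free :: "('a::euclidean_space vfield \<Rightarrow> 'a vfield \<Rightarrow> 'a vfield) \<Rightarrow> bool" where
  "torsion_free nabla \<longleftrightarrow>
     (\<forall>X Y. smooth X \<longrightarrow> smooth Y \<longrightarrow>
        (\<lambda>p. nabla X Y p - nabla Y X p) = lie_bracket X Y)"

definition curvature ::
  "('a::euclidean_space vfield \<Rightarrow> 'a vfield \<Rightarrow> 'a vfield)
     \<Rightarrow> 'a vfield \<Rightarrow> 'a vfield \<Rightarrow> 'a vfield \<Rightarrow> 'a vfield" where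
  "curvature nabla X Y Z =
     (\<lambda>p. nabla X (nabla Y Z) p - nabla Y (nabla X Z) p - nabla (lie_bracket X Y) Z p)"

text \<open>The curvature of a connection is tensorial, so its value on tangent vectors
  \<open>x, y, z\<close> at \<open>P\<close> can be computed with any smooth extensions to vector fields. We use
  the constant ones given by the canonical identification \<open>T\<^sub>PV = V\<close>.\<close>

definition curvature_at ::
  "('a::euclidean_space vfield \<Rightarrow> 'a vfield \<Rightarrow> 'a vfield) \<Rightarrow> 'a \<Rightarrow> 'a curv_op" where
  "curvature_at nabla P x y z = curvature nabla (\<lambda>_. x) (\<lambda>_. y) (\<lambda>_. z) P"

definition projectively_flat_connection ::
  "('a::euclidean_space vfield \<Rightarrow> 'a vfield \<Rightarrow> 'a vfield) \<Rightarrow> bool" where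
  "projectively_flat_connection nabla \<longleftrightarrow> (\<forall>P. projectively_flat (curvature_at nabla P))"

definition ricci_symmetric_connection ::
  "('a::euclidean_space vfield \<Rightarrow> 'a vfield \<Rightarrow> 'a vfield) \<Rightarrow> bool" where
  "ricci_symmetric_connection nabla \<longleftrightarrow> (\<forall>P. ricci_symmetric (curvature_at nabla P))"

end

theory Submission
  imports Defs
begin

text \<open>
  A torsion free connection that has the same unparametrized geodesics as the flat connection
  \<open>D\<close> has the form \<open>\<nabla>\<^sub>X Y = D\<^sub>X Y + \<omega>(X) Y + \<omega>(Y) X\<close> for a one-form
  \<open>\<omega>\<close>. Differentiating once more gives its curvature as \<open>H(\<Theta>)\<close> with
  \<open>\<Theta>(x,y) = (D\<^sub>x \<omega>)(y) - \<omega>(x) \<omega>(y)\<close>, see \<open>curvature_at_projective_change\<close>. The trace identity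
  \<open>\<rho>(H(\<Theta>))(x,y) = \<Theta>(y,x) - m \<Theta>(x,y)\<close> shows that the operators \<open>H(\<Theta>)\<close> are
  projectively flat, and that they are Ricci symmetric when \<open>\<Theta>\<close> is symmetric. Hence every such
  connection is projectively flat, and it is Ricci symmetric when \<open>\<omega>\<close> is closed.

  Conversely, a projectively flat \<open>A\<close> equals \<open>H(\<Theta>)\<close> where \<open>\<Theta>\<close> is read off from the Ricci
  tensor of \<open>A\<close>. The one-form whose coefficients are linear, \<open>\<omega>\<^sub>P(y) = \<Theta>(P,y)\<close>, vanishes at
  \<open>0\<close> and satisfies \<open>(D\<^sub>x \<omega>)(y) = \<Theta>(x,y)\<close>, so the curvature at \<open>0\<close> is exactly \<open>A\<close>. If
  \<open>A\<close> is Ricci symmetric then \<open>\<Theta>\<close> is symmetric, so \<open>\<omega>\<close> is closed, and one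
  connection serves for both claims.
\<close>

section \<open>Calculus of smooth maps\<close>

lemma frechet_derivative_eqI:
  assumes "(f has_derivative f') (at p)"
  shows "frechet_derivative f (at p) = f'"
  using frechet_derivative_at[OF assms] by simp

lemma differentiable_has_frechet_derivative:
  assumes "f differentiable (at p)"
  shows "(f has_derivative frechet_derivative f (at p)) (at p)"
  using assms frechet_derivative_works by blast

lemma frechet_derivative_add:
  assumes "f differentiable (at p)" "g differentiable (at p)"
  shows "frechet_derivative (\<lambda>p. f p + g p) (at p) v
    = frechet_derivative f (at p) v + frechet_derivative g (at p) v"
  using assms[THEN differentiable_has_frechet_derivative]
  by (simp add: frechet_derivative_eqI[OF has_derivative_add])

lemma C_k_Suc_imp_C_k:
  "C_k (Suc k) f \<Longrightarrow> C_k k f"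
proof (induction k arbitrary: f)
  case 0
  then show ?case
    by (auto intro!: continuous_at_imp_continuous_on differentiable_imp_continuous_within)
next
  case (Suc k)
  then show ?case
    by (metis C_k.simps(2))
qed

lemma C_k_const: "C_k k (\<lambda>p. c)"
  by (induction k arbitrary: c) (auto simp: frechet_derivative_const)

lemma C_k_add:
  "C_k k f \<Longrightarrow> C_k k g \<Longrightarrow> C_k k (\<lambda>p. f p + g p)"
proof (induction k arbitrary: f g)
  case 0
  then show ?case by (auto intro: continuous_on_add)
next
  case (Suc k)
  have "frechet_derivative (\<lambda>p. f p + g p) (at p) v
      = frechet_derivative f (at p) v + frechet_derivative g (at p) v" for p v
    using Suc.prems by (simp add: frechet_derivative_add)
  with Suc show ?case by auto
qed

text \<open>By the Leibniz rule the directional derivatives of a product are sums of products in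
  which each factor has lost at most one order of differentiability.\<close>
lemma C_k_bilinear:
  assumes "bounded_bilinear B"
  shows "C_k k f \<Longrightarrow> C_k k g \<Longrightarrow> C_k k (\<lambda>p. B (f p) (g p))"
proof (induction k arbitrary: f g)
  case 0
  then show ?case
    using bounded_bilinear.continuous_on[OF assms] by auto
next
  case (Suc k)
  have *: "((\<lambda>p. B (f p) (g p)) has_derivative
      (\<lambda>v. B (f p) (frechet_derivative g (at p) v) + B (frechet_derivative f (at p) v) (g p)))
      (at p)" for p
    using Suc.prems
    by (intro bounded_bilinear.FDERIV[OF assms] differentiable_has_frechet_derivative) auto
  have "C_k k f" "C_k k g"
    using Suc.prems C_k_Suc_imp_C_k by blast+
  with Suc * show ?case
    by (auto simp: frechet_derivative_eqI[OF *] differentiable_def intro!: C_k_add)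
qed

lemma C_k_bounded_linear:
  assumes "bounded_linear f"
  shows "C_k k f"
proof (cases k)
  case 0
  then show ?thesis using assms by (simp add: linear_continuous_on)
next
  case (Suc j)
  have "(f has_derivative f) (at p)" for p
    using assms by (rule bounded_linear_imp_has_derivative)
  then have "frechet_derivative f (at p) = f" "f differentiable (at p)" for p
    by (auto intro: frechet_derivative_eqI differentiableI)
  then show ?thesis using Suc by (simp add: C_k_const)
qed

lemma smooth_const: "smooth (\<lambda>p. c)"
  by (simp add: smooth_def C_k_const)

lemma smooth_bounded_linear: "bounded_linear f \<Longrightarrow> smooth f"
  by (simp add: smooth_def C_k_bounded_linear)

lemma smooth_add: "smooth f \<Longrightarrow> smooth g \<Longrightarrow> smooth (\<lambda>p. f p + g p)"
  by (simp add: smooth_def C_k_add)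

lemma smooth_scaleR:
  "smooth f \<Longrightarrow> smooth g \<Longrightarrow> smooth (\<lambda>p. f p *\<^sub>R g p)"
  by (simp add: smooth_def C_k_bilinear[OF bounded_bilinear_scaleR])

lemma smooth_inner_const: "smooth f \<Longrightarrow> smooth (\<lambda>p. f p \<bullet> c)"
  by (simp add: smooth_def C_k_bilinear[OF bounded_bilinear_inner] C_k_const)

lemma smooth_sum: "(\<And>i. i \<in> I \<Longrightarrow> smooth (f i)) \<Longrightarrow> smooth (\<lambda>p. \<Sum>i\<in>I. f i p)"
  by (induction I rule: infinite_finite_induct) (simp_all add: smooth_const smooth_add)

lemma smooth_imp_differentiable: "smooth f \<Longrightarrow> f differentiable (at p)"
  by (metis C_k.simps(2) smooth_def)

lemma smooth_has_derivative:
  "smooth f \<Longrightarrow> (f has_derivative frechet_derivative f (at p)) (at p)"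
  by (simp add: differentiable_has_frechet_derivative smooth_imp_differentiable)

lemma smooth_directional_derivative:
  "smooth f \<Longrightarrow> smooth (\<lambda>p. frechet_derivative f (at p) v)"
  unfolding smooth_def by (metis C_k.simps(2))

lemma linear_expand_Basis:
  fixes f :: "'a::euclidean_space \<Rightarrow> 'b::real_normed_vector"
  assumes "linear f"
  shows "f x = (\<Sum>b\<in>Basis. (x \<bullet> b) *\<^sub>R f b)"
proof -
  have "f x = f (\<Sum>b\<in>Basis. (x \<bullet> b) *\<^sub>R b)"
    by (simp add: euclidean_representation)
  then show ?thesis
    using assms by (simp add: linear_sum linear_scale)
qed

text \<open>Expanding the argument in a basis reduces the smoothness of \<open>p \<mapsto> L p (X p)\<close> to that of
  the coefficients \<open>p \<mapsto> L p b\<close>. This covers both the derivative along a non-constant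
  vector field and the evaluation of a one-form on it.\<close>
lemma smooth_linear_family:
  fixes L :: "'c::euclidean_space \<Rightarrow> 'a::euclidean_space \<Rightarrow> 'b::real_normed_vector"
  assumes "\<And>p. linear (L p)" "\<And>v. smooth (\<lambda>p. L p v)" "smooth X"
  shows "smooth (\<lambda>p. L p (X p))"
proof -
  have "(\<lambda>p. L p (X p)) = (\<lambda>p. \<Sum>b\<in>Basis. (X p \<bullet> b) *\<^sub>R L p b)"
    using assms(1) linear_expand_Basis by blast
  then show ?thesis
    using assms by (auto intro!: smooth_sum smooth_scaleR smooth_inner_const)
qed

lemma smooth_derivative_along:
  assumes "smooth f" "smooth X"
  shows "smooth (\<lambda>p. frechet_derivative f (at p) (X p))"
  using assms(2)
  by (rule smooth_linear_family[where L = "\<lambda>p. frechet_derivative f (at p)", rotated 2])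
    (use assms(1) in \<open>auto intro: linear_frechet_derivative smooth_imp_differentiable
      smooth_directional_derivative\<close>)

section \<open>The operators \<open>H(\<Theta>)\<close>\<close>

text \<open>The first summand \<open>z \<mapsto> \<Theta>(z,x) y\<close> of the endomorphism being traced has rank one, so its
  trace is \<open>\<Theta>(y,x)\<close>; likewise for the next two. The fourth is \<open>- \<Theta>(x,y)\<close> times the identity.\<close>
lemma ricci_H_op:
  fixes T :: "'a::euclidean_space \<Rightarrow> 'a \<Rightarrow> real"
  assumes "bilinear T"
  shows "ricci (H_op T) x y = T y x - real DIM('a) * T x y"
proof -
  have rank_one: "(\<Sum>b\<in>Basis. f b * (v \<bullet> b)) = f v" if "linear f" for f and v :: 'a
    using linear_expand_Basis[OF that, of v] by (simp add: mult.commute)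
  have "linear (\<lambda>z. T z x)" "linear (T x)" "linear (\<lambda>z. T z y)"
    using assms by (auto simp: bilinear_def)
  note traces = this[THEN rank_one]
  have "ricci (H_op T) x y = (\<Sum>b\<in>Basis. T b x * (y \<bullet> b)) - (\<Sum>b\<in>Basis. T x b * (y \<bullet> b))
      + (\<Sum>b\<in>Basis. T b y * (x \<bullet> b)) - (\<Sum>b\<in>(Basis::'a set). T x y)"
    unfolding ricci_def endo_trace_def H_op_def sum.distrib[symmetric] sum_subtractf[symmetric]
    by (intro sum.cong) (auto simp: algebra_simps)
  then show ?thesis
    by (simp add: traces)
qed

text \<open>The symmetric part of the Ricci tensor of \<open>H(\<Theta>)\<close> is \<open>(1 - m) \<Theta>\<^sub>s\<close> and the antisymmetric
  part is \<open>- (1 + m) \<Theta>\<^sub>a\<close>, so the two correction terms of the projective curvature are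
  \<open>- H(\<Theta>\<^sub>s)\<close> and \<open>- H(\<Theta>\<^sub>a)\<close>.\<close>
lemma projectively_flat_H_op:
  fixes T :: "'a::euclidean_space \<Rightarrow> 'a \<Rightarrow> real"
  assumes "bilinear T" "DIM('a) \<ge> 2"
  shows "projectively_flat (H_op T)"
proof -
  define m where "m = real DIM('a)"
  have m: "m - 1 \<noteq> 0" "1 + m \<noteq> 0"
    using assms(2) by (auto simp: m_def)
  have sym: "ricci_sym (H_op T) = (\<lambda>u v. - (m - 1) * ((T u v + T v u) / 2))"
    by (intro ext) (simp add: ricci_sym_def ricci_H_op[OF assms(1)] m_def field_simps)
  have alt: "ricci_alt (H_op T) = (\<lambda>u v. - (1 + m) * ((T u v - T v u) / 2))"
    by (intro ext) (simp add: ricci_alt_def ricci_H_op[OF assms(1)] m_def field_simps)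
  have H_scale: "(1 / c) *\<^sub>R H_op (\<lambda>u v. - c * S u v) x y z = - H_op S x y z"
    if "c \<noteq> 0" for c S and x y z :: 'a
    using that by (simp add: H_op_def algebra_simps)
  have T_eq: "T = (\<lambda>u v. (T u v + T v u) / 2 + (T u v - T v u) / 2)"
    by (intro ext) (simp add: field_simps)
  have H_add: "H_op (\<lambda>u v. S u v + K u v) x y z = H_op S x y z + H_op K x y z"
    for S K and x y z :: 'a
    by (simp add: H_op_def scaleR_add_left)
  have split: "H_op T x y z = H_op (\<lambda>u v. (T u v + T v u) / 2) x y z
      + H_op (\<lambda>u v. (T u v - T v u) / 2) x y z" for x y z
    unfolding H_add[symmetric] by (rule arg_cong[where f = "\<lambda>S. H_op S x y z", OF T_eq])
  have "proj_curv (H_op T) x y z = 0" for x y z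
    unfolding proj_curv_def m_def[symmetric] sym alt H_scale[OF m(1)] H_scale[OF m(2)]
    by (simp add: split)
  then show ?thesis
    by (simp add: projectively_flat_def)
qed

lemma ricci_symmetric_H_op:
  fixes T :: "'a::euclidean_space \<Rightarrow> 'a \<Rightarrow> real"
  assumes "bilinear T" "\<And>x y. T x y = T y x"
  shows "ricci_symmetric (H_op T)"
  using assms(2) by (auto simp: ricci_symmetric_def ricci_alt_def ricci_H_op[OF assms(1)])

text \<open>The projective Schouten tensor, up to sign: the solution \<open>\<Theta>\<close> of
  \<open>\<rho>(A)(x,y) = \<Theta>(y,x) - m \<Theta>(x,y)\<close>, found by treating the symmetric and antisymmetric parts
  separately.\<close>
definition schouten :: "'a::euclidean_space curv_op \<Rightarrow> 'a \<Rightarrow> 'a \<Rightarrow> real" where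
  "schouten A x y = - ricci_sym A x y / (real DIM('a) - 1) - ricci_alt A x y / (1 + real DIM('a))"

lemma projectively_flat_eq_H_op_schouten:
  assumes "projectively_flat A"
  shows "A = H_op (schouten A)"
proof (intro ext)
  fix x y z
  have "proj_curv A x y z = 0"
    using assms by (simp add: projectively_flat_def)
  then have "A x y z = - (1 / (real DIM('a) - 1)) *\<^sub>R H_op (ricci_sym A) x y z
      - (1 / (1 + real DIM('a))) *\<^sub>R H_op (ricci_alt A) x y z"
    by (simp add: proj_curv_def algebra_simps eq_neg_iff_add_eq_0)
  also have "\<dots> = H_op (schouten A) x y z"
    by (simp add: H_op_def schouten_def algebra_simps)
  finally show "A x y z = H_op (schouten A) x y z" .
qed

lemma bilinear_ricci:
  assumes "A \<in> curvature_operators"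
  shows "bilinear (ricci A)"
proof -
  have "linear (\<lambda>x. A b x y)" "linear (A b x)" for b x y
    using assms unfolding curvature_operators_def bilinear_def by blast+
  note A_simps = linear_add[OF this(1)] linear_add[OF this(2)]
    linear_cmul[OF this(1)] linear_cmul[OF this(2)]
  show ?thesis
    unfolding bilinear_def ricci_def endo_trace_def
    by (auto intro!: linearI simp: A_simps inner_add_left sum.distrib sum_distrib_left)
qed

lemma bilinear_schouten:
  assumes "A \<in> curvature_operators"
  shows "bilinear (schouten A)"
proof -
  note ric = bilinear_ricci[OF assms]
  have coeffs: "- ((p + q) / 2) / c - ((p - q) / 2) / d
      = (- inverse c - inverse d) / 2 * p + (inverse d - inverse c) / 2 * q" for c d p q :: real
    by (cases "c = 0"; cases "d = 0") (simp_all add: field_simps)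
  have "schouten A = (\<lambda>x y.
      (- inverse (real DIM('a) - 1) - inverse (1 + real DIM('a))) / 2 * ricci A x y
      + (inverse (1 + real DIM('a)) - inverse (real DIM('a) - 1)) / 2 * ricci A y x)"
    by (intro ext) (simp only: schouten_def ricci_sym_def ricci_alt_def coeffs)
  moreover have "bilinear (\<lambda>x y. a * ricci A x y + b * ricci A y x)" for a b
    unfolding bilinear_def
    by (intro conjI allI linearI) (simp_all add: bilinear_ladd[OF ric] bilinear_radd[OF ric]
        bilinear_lmul[OF ric] bilinear_rmul[OF ric] distrib_left mult.left_commute)
  ultimately show ?thesis
    by (simp only:)
qed

lemma schouten_symmetric:
  assumes "ricci_symmetric A"
  shows "schouten A x y = schouten A y x"
  using assms by (simp add: schouten_def ricci_symmetric_def ricci_sym_def add.commute)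

section \<open>Projective changes of the flat connection\<close>

definition projective_change ::
  "('a::euclidean_space \<Rightarrow> 'a \<Rightarrow> real) \<Rightarrow> 'a vfield \<Rightarrow> 'a vfield \<Rightarrow> 'a vfield" where
  "projective_change \<omega> X Y =
     (\<lambda>p. frechet_derivative Y (at p) (X p) + \<omega> p (X p) *\<^sub>R Y p + \<omega> p (Y p) *\<^sub>R X p)"

definition one_form :: "('a::euclidean_space \<Rightarrow> 'a \<Rightarrow> real) \<Rightarrow> bool" where
  "one_form \<omega> \<longleftrightarrow> (\<forall>p. linear (\<omega> p)) \<and> (\<forall>v. smooth (\<lambda>p. \<omega> p v))"

text \<open>The terms \<open>\<omega>(X) Y + \<omega>(Y) X\<close> are linear over the smooth functions in both arguments, so
  the Leibniz rule for \<open>\<nabla>\<close> is inherited from \<open>D\<close>.\<close>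
lemma connection_projective_change:
  assumes "one_form \<omega>"
  shows "connection (projective_change \<omega>)"
proof -
  have lin: "linear (\<omega> p)" and sm: "smooth (\<lambda>p. \<omega> p v)" for p v
    using assms by (auto simp: one_form_def)
  note w_simps = linear_add[OF lin] linear_cmul[OF lin]
  note d_lin = linear_frechet_derivative[OF smooth_imp_differentiable]
  note d_simps = linear_add[OF d_lin] linear_cmul[OF d_lin]
  have d_add: "frechet_derivative (\<lambda>p. Y p + Y' p) (at p) v
      = frechet_derivative Y (at p) v + frechet_derivative Y' (at p) v"
    if "smooth Y" "smooth Y'" for Y Y' :: "'a vfield" and p v
    using that by (simp add: frechet_derivative_add smooth_imp_differentiable)
  have d_scale: "frechet_derivative (\<lambda>p. f p *\<^sub>R Y p) (at p) v
      = f p *\<^sub>R frechet_derivative Y (at p) v + frechet_derivative f (at p) v *\<^sub>R Y p"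
    if "smooth f" "smooth Y" for f and Y :: "'a vfield" and p v
    by (subst frechet_derivative_eqI[OF has_derivative_scaleR
          [OF smooth_has_derivative[OF that(1)] smooth_has_derivative[OF that(2)]]]) simp
  show ?thesis
    unfolding connection_def projective_change_def
    by (auto simp: w_simps d_simps d_add d_scale algebra_simps
        intro!: smooth_add smooth_scaleR smooth_derivative_along
          smooth_linear_family[where L = \<omega>] lin sm)
qed

lemma torsion_free_projective_change: "torsion_free (projective_change \<omega>)"
  by (auto simp: torsion_free_def projective_change_def lie_bracket_def)

text \<open>The tensor \<open>\<Theta>\<close> for which the changed connection has curvature \<open>H(\<Theta>)\<close>.\<close>
definition change_tensor :: "('a::euclidean_space \<Rightarrow> 'a \<Rightarrow> real) \<Rightarrow> 'a \<Rightarrow> 'a \<Rightarrow> 'a \<Rightarrow> real" where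
  "change_tensor \<omega> p x y = frechet_derivative (\<lambda>q. \<omega> q y) (at p) x - \<omega> p x * \<omega> p y"

lemma bilinear_change_tensor:
  assumes "one_form \<omega>"
  shows "bilinear (change_tensor \<omega> p)"
proof -
  have lin: "linear (\<omega> p)" and sm: "smooth (\<lambda>p. \<omega> p v)" for p v
    using assms by (auto simp: one_form_def)
  note w_simps = linear_add[OF lin] linear_cmul[OF lin]
  note d_lin = linear_frechet_derivative[OF smooth_imp_differentiable[OF sm]]
  note d_simps = linear_add[OF d_lin] linear_cmul[OF d_lin]
  have d_add: "frechet_derivative (\<lambda>q. \<omega> q u + \<omega> q v) (at p) x
      = frechet_derivative (\<lambda>q. \<omega> q u) (at p) x + frechet_derivative (\<lambda>q. \<omega> q v) (at p) x" for u v x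
    by (simp add: frechet_derivative_add smooth_imp_differentiable sm)
  have d_cmul: "frechet_derivative (\<lambda>q. c * \<omega> q v) (at p) x
      = c * frechet_derivative (\<lambda>q. \<omega> q v) (at p) x" for c v x
    by (subst frechet_derivative_eqI[OF has_derivative_mult_right[OF smooth_has_derivative[OF sm]]])
      simp
  show ?thesis
    unfolding bilinear_def change_tensor_def
    by (auto intro!: linearI simp: w_simps d_simps d_add d_cmul algebra_simps)
qed

text \<open>For constant fields \<open>\<nabla>\<^sub>y z = \<omega>(y) z + \<omega>(z) y\<close>. Applying \<open>\<nabla>\<^sub>x\<close> produces the derivatives of
  \<open>\<omega>\<close> and the quadratic terms \<open>2 \<omega>(y) \<omega>(z) x + \<omega>(x) \<omega>(z) y + \<omega>(x) \<omega>(y) z\<close>, of which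
  \<open>\<omega>(y) \<omega>(z) x - \<omega>(x) \<omega>(z) y\<close> survives antisymmetrization in \<open>x\<close> and \<open>y\<close>.\<close>
lemma curvature_at_projective_change:
  fixes \<omega> :: "'a::euclidean_space \<Rightarrow> 'a \<Rightarrow> real"
  assumes "one_form \<omega>"
  shows "curvature_at (projective_change \<omega>) p = H_op (change_tensor \<omega> p)"
proof (intro ext)
  fix x y z :: 'a
  have lin: "linear (\<omega> p)" and sm: "smooth (\<lambda>p. \<omega> p v)" for p v
    using assms by (auto simp: one_form_def)
  note w_simps = linear_add[OF lin] linear_cmul[OF lin] linear_0[OF lin]
  define d where "d = (\<lambda>u v. frechet_derivative (\<lambda>q. \<omega> q v) (at p) u)"
  have first: "projective_change \<omega> (\<lambda>_. u) (\<lambda>_. v) = (\<lambda>q. \<omega> q u *\<^sub>R v + \<omega> q v *\<^sub>R u)" for u v :: 'a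
    by (simp add: projective_change_def frechet_derivative_const)
  have deriv: "frechet_derivative (\<lambda>q. \<omega> q u *\<^sub>R v + \<omega> q v *\<^sub>R u) (at p) t
      = d t u *\<^sub>R v + d t v *\<^sub>R u" for t u v :: 'a
    by (subst frechet_derivative_eqI[OF has_derivative_add
          [OF has_derivative_scaleR_left[OF smooth_has_derivative[OF sm]]
              has_derivative_scaleR_left[OF smooth_has_derivative[OF sm]]]])
      (simp add: d_def)
  have second: "projective_change \<omega> (\<lambda>_. t) (\<lambda>q. \<omega> q u *\<^sub>R v + \<omega> q v *\<^sub>R u) p
      = d t u *\<^sub>R v + d t v *\<^sub>R u + \<omega> p t *\<^sub>R (\<omega> p u *\<^sub>R v + \<omega> p v *\<^sub>R u)
        + (2 * \<omega> p u * \<omega> p v) *\<^sub>R t" for t u v :: 'a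
    by (simp add: projective_change_def deriv w_simps)
  have bracket: "lie_bracket (\<lambda>_. x) (\<lambda>_. y) = (\<lambda>_. 0)"
    by (simp add: lie_bracket_def frechet_derivative_const)
  have double: "(2 * r) *\<^sub>R v = r *\<^sub>R v + r *\<^sub>R v" for r and v :: 'a
    by (simp only: mult_2 scaleR_add_left)
  have "curvature_at (projective_change \<omega>) p x y z
      = d x y *\<^sub>R z - d y x *\<^sub>R z + d x z *\<^sub>R y - d y z *\<^sub>R x
        + (\<omega> p y * \<omega> p z) *\<^sub>R x - (\<omega> p x * \<omega> p z) *\<^sub>R y"
    unfolding curvature_at_def curvature_def bracket first second
    by (simp add: w_simps double algebra_simps)
  also have "\<dots> = H_op (change_tensor \<omega> p) x y z"
    by (simp add: H_op_def change_tensor_def d_def algebra_simps)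
  finally show "curvature_at (projective_change \<omega>) p x y z = H_op (change_tensor \<omega> p) x y z" .
qed

lemma projectively_flat_projective_change:
  fixes \<omega> :: "'a::euclidean_space \<Rightarrow> 'a \<Rightarrow> real"
  assumes "one_form \<omega>" "DIM('a) \<ge> 2"
  shows "projectively_flat_connection (projective_change \<omega>)"
  using assms
  by (simp add: projectively_flat_connection_def curvature_at_projective_change
      projectively_flat_H_op bilinear_change_tensor)

text \<open>The hypothesis on the derivatives says that \<open>\<omega>\<close> is closed; the quadratic term of
  the change tensor is always symmetric.\<close>
lemma ricci_symmetric_projective_change:
  assumes "one_form \<omega>"
    and "\<And>p x y. frechet_derivative (\<lambda>q. \<omega> q y) (at p) x = frechet_derivative (\<lambda>q. \<omega> q x) (at p) y"
  shows "ricci_symmetric_connection (projective_change \<omega>)"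
proof -
  have "change_tensor \<omega> p x y = change_tensor \<omega> p y x" for p x y
    using assms(2) by (simp add: change_tensor_def mult.commute)
  then show ?thesis
    using assms(1)
    by (simp add: ricci_symmetric_connection_def curvature_at_projective_change
        ricci_symmetric_H_op bilinear_change_tensor)
qed

section \<open>Realization\<close>

lemma linear_coefficient_derivative:
  fixes T :: "'a::euclidean_space \<Rightarrow> 'a \<Rightarrow> real"
  assumes "bilinear T"
  shows "frechet_derivative (\<lambda>q. T q y) (at p) x = T x y"
proof -
  have "bounded_linear (\<lambda>q. T q y)"
    using assms by (auto simp: bilinear_def linear_conv_bounded_linear)
  then have "((\<lambda>q. T q y) has_derivative (\<lambda>q. T q y)) (at p)"
    by (rule bounded_linear_imp_has_derivative)
  then show ?thesis
    by (simp add: frechet_derivative_eqI)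
qed

theorem theorem1p7:
  fixes A :: "'a::euclidean_space curv_op"
  assumes "DIM('a) \<ge> 3"
    and "A \<in> curvature_operators"
  shows "(projectively_flat A \<longrightarrow>
           (\<exists>nabla. connection nabla \<and> torsion_free nabla \<and>
              projectively_flat_connection nabla \<and> curvature_at nabla 0 = A))
       \<and> (projectively_flat A \<and> ricci_symmetric A \<longrightarrow>
           (\<exists>nabla. connection nabla \<and> torsion_free nabla \<and>
              projectively_flat_connection nabla \<and> ricci_symmetric_connection nabla \<and>
              curvature_at nabla 0 = A))"
proof -
  define \<omega> where "\<omega> = schouten A"
  have bil: "bilinear \<omega>"
    unfolding \<omega>_def using assms(2) by (rule bilinear_schouten)
  then have form: "one_form \<omega>"
    by (auto simp: one_form_def bilinear_def linear_conv_bounded_linear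
        intro: smooth_bounded_linear)
  have "change_tensor \<omega> 0 = \<omega>"
    using bil
    by (intro ext) (simp add: change_tensor_def linear_coefficient_derivative bilinear_lzero)
  then have "curvature_at (projective_change \<omega>) 0 = A" if "projectively_flat A"
    using form projectively_flat_eq_H_op_schouten[OF that]
    by (simp add: curvature_at_projective_change \<omega>_def)
  moreover have "ricci_symmetric_connection (projective_change \<omega>)" if "ricci_symmetric A"
    using form
  proof (rule ricci_symmetric_projective_change)
    show "frechet_derivative (\<lambda>q. \<omega> q y) (at p) x = frechet_derivative (\<lambda>q. \<omega> q x) (at p) y" for p x y
      using schouten_symmetric[OF that, of x y]
      by (simp add: linear_coefficient_derivative[OF bil] flip: \<omega>_def)
  qed
  moreover have "projectively_flat_connection (projective_change \<omega>)"
    using form assms(1) by (intro projectively_flat_projective_change) auto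
  ultimately show ?thesis
    using connection_projective_change[OF form] torsion_free_projective_change by blast
qed

end
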